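(* Let $[a,b]\subset[0,1]$ be a closed interval, let $\epsilon>0$ be small, and let $f:[a,b]\to(0,1]$ be $1$-Lipschitz. Consider the following adaptive algorithm: initialize $L_{todo}=\{[a,b]\}$ and $L_{final}=\emptyset$; while $L_{todo}$ is nonempty, build $L_{next}=\emptyset$ and, for each $[c,d]\in L_{todo}$, if $\min\{f(c),f(d)\}\,\epsilon\ge |c-d|$ add $[c,d]$ to $L_{final}$, otherwise add the two halves $[c,\frac{c+d}{2}]$ and $[\frac{c+d}{2},d]$ to $L_{next}$; then set $L_{todo}=L_{next}$. Return $L_{final}$. Then the algorithm terminates, there is an interval $[c,d]\in L_{final}$ such that $$\left|\frac{\inf_{[a,b]} f}{\min_{x\in\{c,d\}} f(x)}-1\right|\le\epsilon,$$ and the algorithm performs $O\!\left(\frac{1}{\epsilon}\int_a^b\frac{1}{f(x)}\,dx\right)$ evaluations of $f$.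
   Context: The cost of the algorithm is measured as the total number of evaluations of $f$ performed. *)

theory Defs
  imports "HOL-Analysis.Analysis" "HOL-Library.While_Combinator"
begin

text \<open>
  A closed interval $[c,d]$ is represented by the pair \<open>(c, d)\<close> of its endpoints. The algorithm
  has access to \<open>f\<close> only through \<open>query\<close>, which increments the number of evaluations
  performed so far. There is no caching: evaluating \<open>f\<close> again at an endpoint shared with
  another interval is counted again.
\<close>

type_synonym interval = "real \<times> real"

definition query :: "(real \<Rightarrow> real) \<Rightarrow> real \<Rightarrow> nat \<Rightarrow> real \<times> nat" where
  "query f x n = (f x, Suc n)"

text \<open>
  The state threaded through the inner loop consists of \<open>L_next\<close>, \<open>L_final\<close> and the number of
  evaluations.
\<close>

fun process ::
  "(real \<Rightarrow> real) \<Rightarrow> real \<Rightarrow> interval \<Rightarrow>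
    interval list \<times> interval list \<times> nat \<Rightarrow> interval list \<times> interval list \<times> nat" where
  "process f \<epsilon> (c, d) (L_next, L_final, n) =
    (let (fc, n') = query f c n;
         (fd, n'') = query f d n'
     in if min fc fd * \<epsilon> \<ge> \<bar>c - d\<bar>
        then (L_next, L_final @ [(c, d)], n'')
        else (L_next @ [(c, (c + d) / 2), ((c + d) / 2, d)], L_final, n''))"

text \<open>
  In the state of the outer loop the first component is \<open>L_todo\<close>; the \<open>L_next\<close> built by one
  pass becomes the next \<open>L_todo\<close>.
\<close>

fun refine ::
  "(real \<Rightarrow> real) \<Rightarrow> real \<Rightarrow>
    interval list \<times> interval list \<times> nat \<Rightarrow> interval list \<times> interval list \<times> nat" where
  "refine f \<epsilon> (L_todo, L_final, n) = fold (process f \<epsilon>) L_todo ([], L_final, n)"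

text \<open>
  The result is \<open>None\<close> if the loop does not terminate, and otherwise \<open>Some\<close> of the final state
  \<open>([], L_final, n)\<close>, with \<open>n\<close> the total number of evaluations.
\<close>

definition adaptive_bisection ::
  "(real \<Rightarrow> real) \<Rightarrow> real \<Rightarrow> real \<Rightarrow> real \<Rightarrow>
    (interval list \<times> interval list \<times> nat) option" where
  "adaptive_bisection f \<epsilon> a b =
    while_option (\<lambda>(L_todo, L_final, n). L_todo \<noteq> []) (refine f \<epsilon>) ([(a, b)], [], 0)"

end

theory Submission
  imports Defs
begin

text \<open>
  Every bisected interval of length \<open>2l\<close> has an endpoint \<open>p\<close> with \<open>f p * \<epsilon> < 2l\<close>, so the Lipschitz
  condition gives \<open>f * \<epsilon> \<le> 4l\<close> on it when \<open>\<epsilon> \<le> 1\<close>: each of its halves contributes at least \<open>\<epsilon>/4\<close>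
  to the integral of \<open>1/f\<close>. The returned intervals tile \<open>[a,b]\<close>, which bounds their number, and in
  the binary tree of all intervals the leaves are more than half of the nodes. The returned
  interval containing a minimiser of \<open>f\<close> is the required one.
\<close>

section \<open>One pass of the outer loop in closed form\<close>

definition small :: "(real \<Rightarrow> real) \<Rightarrow> real \<Rightarrow> interval \<Rightarrow> bool" where
  "small f \<epsilon> = (\<lambda>(c, d). \<bar>c - d\<bar> \<le> min (f c) (f d) * \<epsilon>)"

definition halves :: "interval \<Rightarrow> interval list" where
  "halves = (\<lambda>(c, d). [(c, (c + d) / 2), ((c + d) / 2, d)])"

text \<open>Every processed interval costs two queries, whether or not it passes the test, so the
  counter grows by \<open>2 * length L\<close>.\<close>

lemma fold_process:
  "fold (process f \<epsilon>) L (L_next, L_final, n) =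
    (L_next @ concat (map halves (filter (\<lambda>I. \<not> small f \<epsilon> I) L)),
     L_final @ filter (small f \<epsilon>) L, n + 2 * length L)"
  by (induction L arbitrary: L_next L_final n)
     (auto simp: query_def small_def halves_def Let_def)

lemma refine_eq:
  "refine f \<epsilon> (L, L_final, n) =
    (concat (map halves (filter (\<lambda>I. \<not> small f \<epsilon> I) L)),
     L_final @ filter (small f \<epsilon>) L, n + 2 * length L)"
  by (simp add: fold_process)

lemma length_concat_halves: "length (concat (map halves L)) = 2 * length L"
  by (induction L) (auto simp: halves_def)

section \<open>Additivity of the integral under bisection\<close>

definition interval_integral :: "(real \<Rightarrow> real) \<Rightarrow> interval \<Rightarrow> real" where
  "interval_integral g = (\<lambda>(c, d). integral {c..d} g)"

lemma sum_interval_integral_halves: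
  assumes "g integrable_on {a..b}" and "\<And>c d. (c, d) \<in> set L \<Longrightarrow> a \<le> c \<and> c \<le> d \<and> d \<le> b"
  shows "sum_list (map (interval_integral g) (concat (map halves L))) =
    sum_list (map (interval_integral g) L)"
  using assms(2)
proof (induction L)
  case (Cons I L)
  obtain c d where I: "I = (c, d)" by fastforce
  then have cd: "a \<le> c" "c \<le> d" "d \<le> b" using Cons.prems[of c d] by auto
  then have "g integrable_on {c..d}"
    by (intro integrable_on_subinterval[OF assms(1)]) auto
  then have "integral {c..(c + d) / 2} g + integral {(c + d) / 2..d} g = integral {c..d} g"
    using cd by (intro Henstock_Kurzweil_Integration.integral_combine) auto
  moreover have "sum_list (map (interval_integral g) (concat (map halves L))) =
      sum_list (map (interval_integral g) L)"
    by (intro Cons.IH) (use Cons.prems in auto)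
  ultimately show ?case
    by (simp add: I halves_def interval_integral_def)
qed simp

lemma sum_list_filter_compl:
  fixes g :: "'a \<Rightarrow> real"
  shows "sum_list (map g (filter P L)) + sum_list (map g (filter (\<lambda>x. \<not> P x) L)) =
    sum_list (map g L)"
  by (induction L) auto

section \<open>The Lipschitz function and the loop invariant\<close>

locale bisection =
  fixes f :: "real \<Rightarrow> real" and a b \<epsilon> :: real
  assumes ab: "a < b" and eps: "\<epsilon> > 0"
    and pos: "\<And>x. x \<in> {a..b} \<Longrightarrow> 0 < f x"
    and le_1: "\<And>x. x \<in> {a..b} \<Longrightarrow> f x \<le> 1"
    and lip: "1-lipschitz_on {a..b} f"
begin

lemma continuous: "continuous_on {a..b} f"
  using lip lipschitz_on_continuous_on by blast

lemma lipschitz_le: "x \<in> {a..b} \<Longrightarrow> y \<in> {a..b} \<Longrightarrow> f x \<le> f y + \<bar>x - y\<bar>"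
  using lipschitz_onD[OF lip, of x y] by (simp add: dist_real_def)

lemma integrable: "(\<lambda>x. 1 / f x) integrable_on {a..b}"
  using pos by (intro integrable_continuous_real continuous_intros continuous) force

text \<open>Iterating without the stopping test makes every state available before termination is
  known; \<open>k\<close> is also the depth of the pending intervals in the bisection tree.\<close>

abbreviation state :: "nat \<Rightarrow> interval list \<times> interval list \<times> nat" where
  "state k \<equiv> (refine f \<epsilon> ^^ k) ([(a, b)], [], 0)"

text \<open>The counting equation comes from the binary tree with leaves \<open>L\<close> and
  \<open>F\<close>: it has \<open>2 * (length L + length F) - 1\<close> nodes, and each node outside
  \<open>L\<close> has cost two evaluations. The equation of integrals stands in for disjointness of
  interiors. The last clause uses \<open>\<epsilon> \<le> 1\<close> for halves and
  \<open>\<epsilon> \<le> b - a\<close> for the initial interval, which is not a half.\<close>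

definition invariant :: "nat \<Rightarrow> interval list \<Rightarrow> interval list \<Rightarrow> nat \<Rightarrow> bool" where
  "invariant k L F n \<longleftrightarrow>
    (\<forall>(c, d) \<in> set L. a \<le> c \<and> d \<le> b \<and> d - c = (b - a) / 2 ^ k) \<and>
    (\<forall>(c, d) \<in> set F. a \<le> c \<and> d \<le> b \<and> c < d \<and> small f \<epsilon> (c, d)) \<and>
    {a..b} \<subseteq> (\<Union>(c, d) \<in> set L \<union> set F. {c..d}) \<and>
    n + 2 = 4 * length F + 2 * length L \<and>
    sum_list (map (interval_integral (\<lambda>x. 1 / f x)) (L @ F)) = integral {a..b} (\<lambda>x. 1 / f x) \<and>
    (\<epsilon> \<le> min 1 (b - a) \<longrightarrow>
      (\<forall>I \<in> set L \<union> set F. \<epsilon> / 4 \<le> interval_integral (\<lambda>x. 1 / f x) I))"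

section \<open>Lower bound for the integral over a half\<close>

lemma integral_ge:
  assumes "a \<le> c" "c \<le> d" "d \<le> b" and "\<And>x. x \<in> {c..d} \<Longrightarrow> e \<le> 1 / f x"
  shows "e * (d - c) \<le> interval_integral (\<lambda>x. 1 / f x) (c, d)"
proof -
  have "integral {c..d} (\<lambda>x. e) \<le> integral {c..d} (\<lambda>x. 1 / f x)"
    using assms by (intro integral_le integrable_on_subinterval[OF integrable]) auto
  then show ?thesis
    using assms by (simp add: interval_integral_def mult.commute)
qed

lemma integral_half_ge:
  assumes "\<epsilon> \<le> 1" and I: "a \<le> c" "c < d" "d \<le> b" "\<not> small f \<epsilon> (c, d)"
    and J: "(c', d') \<in> set (halves (c, d))"
  shows "\<epsilon> / 4 \<le> interval_integral (\<lambda>x. 1 / f x) (c', d')"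
proof -
  \<comment> \<open>The failed test says that the endpoint minimum is too small; \<open>p\<close> is
    an endpoint attaining it.\<close>
  obtain p where p: "p \<in> {c, d}" "f p * \<epsilon> < d - c"
    using I that[of c] that[of d] by (auto simp: small_def min_def split: if_splits)
  have cd: "c \<le> c'" "d' \<le> d" "d' - c' = (d - c) / 2" "c' < d'"
    using J I by (auto simp: halves_def field_simps)
  \<comment> \<open>This constant, multiplied by the half length \<open>(d - c) / 2\<close>, yields
    exactly \<open>\<epsilon> / 4\<close>.\<close>
  have "\<epsilon> / (2 * (d - c)) \<le> 1 / f x" if x: "x \<in> {c'..d'}" for x
  proof -
    have "f x \<le> f p + (d - c)"
      using lipschitz_le[of x p] x p(1) cd I by auto
    then have "f x * \<epsilon> \<le> f p * \<epsilon> + (d - c) * \<epsilon>"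
      using eps by (simp flip: distrib_right)
    \<comment> \<open>The first term is small by the choice of \<open>p\<close>;
      \<open>\<epsilon> \<le> 1\<close> keeps the Lipschitz term below \<open>d - c\<close> as
      well.\<close>
    also have "\<dots> \<le> (d - c) + (d - c) * 1"
      using p(2) I assms(1) by (intro add_mono mult_left_mono) auto
    finally have "\<epsilon> * f x \<le> 2 * (d - c)" by (simp add: mult.commute)
    moreover have "0 < f x" using x cd I by (intro pos) auto
    ultimately show ?thesis using I by (simp add: field_simps)
  qed
  then have "\<epsilon> / (2 * (d - c)) * (d' - c') \<le> interval_integral (\<lambda>x. 1 / f x) (c', d')"
    using cd I by (intro integral_ge) auto
  moreover have "\<epsilon> / (2 * (d - c)) * (d' - c') = \<epsilon> / 4"
    unfolding cd(3) using I by (simp add: divide_simps)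
  ultimately show ?thesis by (simp only:)
qed

section \<open>Establishing and preserving the invariant\<close>

lemma invariant_init: "invariant 0 [(a, b)] [] 0"
proof -
  \<comment> \<open>Since \<open>f \<le> 1\<close>, the integrand is at least 1; the initial
    interval thus contributes at least \<open>b - a\<close>, which exceeds
    \<open>\<epsilon> / 4\<close> once \<open>\<epsilon> \<le> b - a\<close>.\<close>
  have "1 * (b - a) \<le> interval_integral (\<lambda>x. 1 / f x) (a, b)"
    using ab pos le_1 by (intro integral_ge) auto
  then show ?thesis
    using eps by (auto simp: invariant_def interval_integral_def)
qed

lemma invariant_refine:
  assumes inv: "invariant k L F n" and step: "refine f \<epsilon> (L, F, n) = (L', F', n')"
  shows "invariant (Suc k) L' F' n'"
proof -
  let ?S = "filter (small f \<epsilon>) L" and ?B = "filter (\<lambda>I. \<not> small f \<epsilon> I) L"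
  let ?\<mu> = "interval_integral (\<lambda>x. 1 / f x)"
  have L': "L' = concat (map halves ?B)" and F': "F' = F @ ?S" and n': "n' = n + 2 * length L"
    using step unfolding refine_eq by auto
  have len: "0 < (b - a) / 2 ^ k" using ab by simp
  have L: "a \<le> c" "d \<le> b" "d - c = (b - a) / 2 ^ k" "c < d" if "(c, d) \<in> set L" for c d
  proof -
    show *: "a \<le> c" "d \<le> b" "d - c = (b - a) / 2 ^ k"
      using inv that by (auto simp: invariant_def)
    show "c < d" using len * by linarith
  qed
  have next_L: "a \<le> c \<and> d \<le> b \<and> d - c = (b - a) / 2 ^ Suc k" if cd: "(c, d) \<in> set L'" for c d
  proof -
    obtain u v where uv: "(u, v) \<in> set L" "(c, d) \<in> set (halves (u, v))"
      using cd by (auto simp: L')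
    note u = L[OF uv(1)]
    have "u \<le> c" "d \<le> v" "d - c = (v - u) / 2"
      using uv(2) u(4) by (auto simp: halves_def field_simps)
    then show ?thesis using u by simp
  qed
  have next_F: "a \<le> c \<and> d \<le> b \<and> c < d \<and> small f \<epsilon> (c, d)" if "(c, d) \<in> set F'" for c d
    using that L inv by (auto simp: F' invariant_def)
  have cover: "\<exists>(c, d) \<in> set L' \<union> set F'. x \<in> {c..d}" if x: "x \<in> {a..b}" for x
  proof -
    have "{a..b} \<subseteq> (\<Union>(c, d) \<in> set L \<union> set F. {c..d})"
      using inv by (simp add: invariant_def)
    then obtain c d where cd: "(c, d) \<in> set L \<union> set F" "x \<in> {c..d}"
      using x by blast
    show ?thesis
    proof (cases "(c, d) \<in> set F'")
      case True
      then show ?thesis using cd by blast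
    next
      case False
      \<comment> \<open>An interval missing from \<open>F'\<close> has failed the test, so both
        halves are in \<open>L'\<close>; they meet at the midpoint, so one contains
        \<open>x\<close>.\<close>
      then have "(c, d) \<in> set ?B" using cd by (auto simp: F')
      then have "set (halves (c, d)) \<subseteq> set L'" by (auto simp: L')
      moreover have "\<exists>(c', d') \<in> set (halves (c, d)). x \<in> {c'..d'}"
        using cd by (auto simp: halves_def)
      ultimately show ?thesis by blast
    qed
  qed
  \<comment> \<open>With \<open>s\<close> accepted and \<open>r\<close> bisected intervals both
    sides grow by \<open>2 * s + 2 * r\<close>: on the right, \<open>4 * s + 2 * (2 * r)\<close>
    replaces \<open>2 * (s + r)\<close>.\<close>
  have count: "n' + 2 = 4 * length F' + 2 * length L'"
    using inv sum_length_filter_compl[of "small f \<epsilon>" L]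
    by (simp add: L' F' n' invariant_def length_concat_halves)
  have "sum_list (map ?\<mu> L') = sum_list (map ?\<mu> ?B)"
    unfolding L' using L by (intro sum_interval_integral_halves[OF integrable]) force
  then have total: "sum_list (map ?\<mu> (L' @ F')) = integral {a..b} (\<lambda>x. 1 / f x)"
    using inv sum_list_filter_compl[of ?\<mu> "small f \<epsilon>" L]
    by (simp add: F' invariant_def)
  have "\<epsilon> / 4 \<le> ?\<mu> (c, d)"
    if e: "\<epsilon> \<le> min 1 (b - a)" and cd: "(c, d) \<in> set L' \<union> set F'" for c d
  proof (cases "(c, d) \<in> set L'")
    case True
    then obtain u v where "(u, v) \<in> set ?B" "(c, d) \<in> set (halves (u, v))"
      by (auto simp: L')
    then show ?thesis using L[of u v] e by (intro integral_half_ge[of u v]) auto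
  next
    case False
    \<comment> \<open>Acceptance leaves an interval unchanged, so its earlier bound carries
      over.\<close>
    then have "(c, d) \<in> set L \<union> set F" using cd by (auto simp: F')
    then show ?thesis using inv e unfolding invariant_def by blast
  qed
  then have "\<epsilon> \<le> min 1 (b - a) \<longrightarrow> (\<forall>I \<in> set L' \<union> set F'. \<epsilon> / 4 \<le> ?\<mu> I)"
    by auto
  moreover have "\<forall>(c, d) \<in> set L'. a \<le> c \<and> d \<le> b \<and> d - c = (b - a) / 2 ^ Suc k"
    using next_L by blast
  moreover have "\<forall>(c, d) \<in> set F'. a \<le> c \<and> d \<le> b \<and> c < d \<and> small f \<epsilon> (c, d)"
    using next_F by blast
  moreover have "{a..b} \<subseteq> (\<Union>(c, d) \<in> set L' \<union> set F'. {c..d})"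
    using cover by blast
  ultimately show ?thesis
    using count total unfolding invariant_def by (intro conjI)
qed

lemma invariant_state: "case state k of (L, F, n) \<Rightarrow> invariant k L F n"
proof (induction k)
  case 0
  then show ?case using invariant_init by simp
next
  case (Suc k)
  obtain L F n where s: "state k = (L, F, n)" by (rule prod_cases3)
  obtain L' F' n' where s': "refine f \<epsilon> (L, F, n) = (L', F', n')" by (rule prod_cases3)
  show ?case
    using invariant_refine[OF _ s'] Suc.IH s s' by simp
qed

section \<open>Termination through the positive minimum of \<open>f\<close>\<close>

lemma minimum: obtains x where "x \<in> {a..b}" "\<And>y. y \<in> {a..b} \<Longrightarrow> f x \<le> f y"
  using continuous_attains_inf[OF compact_Icc _ continuous] ab by auto

text \<open>Pending intervals at depth \<open>k\<close> have length \<open>(b - a) / 2 ^ k\<close>,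
  while the acceptance threshold never drops below \<open>\<epsilon>\<close> times the minimum of
  \<open>f\<close>. Deep enough, every interval passes.\<close>

lemma todo_eventually_empty: "\<exists>k F n. state k = ([], F, n)"
proof -
  obtain x where x: "x \<in> {a..b}" "\<And>y. y \<in> {a..b} \<Longrightarrow> f x \<le> f y"
    using minimum by blast
  have "0 < f x * \<epsilon>" using pos[OF x(1)] eps by simp
  then obtain k where k: "(b - a) / (f x * \<epsilon>) < 2 ^ k"
    using real_arch_pow[of 2] by force
  then have k': "(b - a) / 2 ^ k < f x * \<epsilon>"
    using \<open>0 < f x * \<epsilon>\<close> by (simp add: field_simps)
  obtain L F n where s: "state k = (L, F, n)" by (rule prod_cases3)
  have inv: "invariant k L F n" using invariant_state[of k] s by simp
  have "small f \<epsilon> (c, d)" if cd: "(c, d) \<in> set L" for c d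
  proof -
    have *: "a \<le> c" "d \<le> b" "d - c = (b - a) / 2 ^ k"
      using inv cd by (auto simp: invariant_def)
    then have "c < d" using ab by (simp flip: diff_gt_0_iff_gt[of d c])
    then have "f x * \<epsilon> \<le> min (f c) (f d) * \<epsilon>"
      using * eps by (intro mult_right_mono) (auto intro!: x(2))
    then show ?thesis using * k' \<open>c < d\<close> by (simp add: small_def)
  qed
  then have "filter (\<lambda>I. \<not> small f \<epsilon> I) L = []"
    by (auto simp: filter_empty_conv)
  \<comment> \<open>The intervals at depth \<open>k\<close> are accepted during the following pass,
    hence \<open>Suc k\<close>.\<close>
  then have "state (Suc k) = ([], F @ filter (small f \<epsilon>) L, n + 2 * length L)"
    using s by (simp add: refine_eq del: refine.simps)
  then show ?thesis by blast
qed

lemma terminates: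
  obtains F n k where "adaptive_bisection f \<epsilon> a b = Some ([], F, n)" "invariant k [] F n"
proof -
  let ?P = "\<lambda>k. fst (state k) = []"
  \<comment> \<open>\<open>while_option\<close> returns the iterate at the first index where the
    guard fails, hence the least \<open>k\<close>.\<close>
  define k where "k = (LEAST k. ?P k)"
  have ex: "\<exists>k. ?P k" using todo_eventually_empty by (metis fst_conv)
  then have "?P k" unfolding k_def by (rule LeastI_ex)
  then obtain F n where s: "state k = ([], F, n)" by (metis prod.collapse)
  have "adaptive_bisection f \<epsilon> a b = Some (state k)"
    using ex unfolding adaptive_bisection_def while_option_def k_def
    by (simp add: case_prod_beta)
  with that[of F n k] invariant_state[of k] s show ?thesis by simp
qed

section \<open>Accuracy of the result and number of evaluations\<close>

lemma approximates_minimum: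
  assumes inv: "invariant k [] F n"
  shows "\<exists>(c, d) \<in> set F. \<bar>(INF x\<in>{a..b}. f x) / min (f c) (f d) - 1\<bar> \<le> \<epsilon>"
proof -
  obtain x where x: "x \<in> {a..b}" "\<And>y. y \<in> {a..b} \<Longrightarrow> f x \<le> f y"
    using minimum by blast
  have INF: "(INF y\<in>{a..b}. f y) = f x"
    by (rule cInf_eq_minimum) (use x in auto)
  have "{a..b} \<subseteq> (\<Union>(c, d) \<in> set F. {c..d})"
    using inv by (simp add: invariant_def)
  then obtain c d where F: "(c, d) \<in> set F" and xcd: "x \<in> {c..d}"
    using x(1) by blast
  then have cd: "a \<le> c" "d \<le> b" "c < d" "small f \<epsilon> (c, d)"
    using inv by (auto simp: invariant_def)
  define M where "M = min (f c) (f d)"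
  have c: "c \<in> {a..b}" and d: "d \<in> {a..b}" using cd by auto
  have M: "0 < M" "f x \<le> M"
    using pos[OF c] pos[OF d] x(2)[OF c] x(2)[OF d] by (auto simp: M_def)
  \<comment> \<open>The acceptance test bounds \<open>d - c\<close> relative to \<open>M\<close>
    itself, so dividing by \<open>M\<close> turns this absolute error into the relative error
    \<open>\<epsilon>\<close>.\<close>
  have "M \<le> f x + (d - c)"
    using lipschitz_le[OF c x(1)] xcd by (auto simp: M_def)
  moreover have "d - c \<le> M * \<epsilon>" using cd by (auto simp: small_def M_def)
  ultimately have "1 - f x / M \<le> \<epsilon>" using M by (simp add: field_simps)
  moreover have "f x / M \<le> 1" using M by simp
  ultimately have "\<bar>f x / M - 1\<bar> \<le> \<epsilon>" using eps by linarith
  then show ?thesis using F INF by (auto simp: M_def)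
qed

text \<open>Each returned interval takes up at least \<open>\<epsilon> / 4\<close> of the integral
  and accounts for at most 4 evaluations, hence the factor 16.\<close>

lemma evaluations_le:
  assumes inv: "invariant k [] F n" and e: "\<epsilon> \<le> min 1 (b - a)"
  shows "real n \<le> 16 * (1 / \<epsilon> * integral {a..b} (\<lambda>x. 1 / f x))"
proof -
  let ?\<mu> = "interval_integral (\<lambda>x. 1 / f x)"
  have "sum_list (map (\<lambda>_. \<epsilon> / 4) F) \<le> sum_list (map ?\<mu> F)"
    using inv e by (intro sum_list_mono) (auto simp: invariant_def)
  then have "real (length F) * (\<epsilon> / 4) \<le> integral {a..b} (\<lambda>x. 1 / f x)"
    using inv by (simp add: invariant_def sum_list_triv)
  then have "4 * real (length F) \<le> 16 * (1 / \<epsilon> * integral {a..b} (\<lambda>x. 1 / f x))"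
    using eps by (simp add: field_simps)
  moreover have "n \<le> 4 * length F" using inv by (simp add: invariant_def)
  ultimately show ?thesis by linarith
qed

end

theorem theorem2p3:
  "\<exists>K>0. \<forall>a b :: real. 0 \<le> a \<and> a < b \<and> b \<le> 1 \<longrightarrow>
    (\<exists>\<epsilon>\<^sub>0>0. \<forall>f :: real \<Rightarrow> real. f ` {a..b} \<subseteq> {0<..1} \<and> 1-lipschitz_on {a..b} f \<longrightarrow>
      (\<forall>\<epsilon>>0. \<exists>L_final n.
        adaptive_bisection f \<epsilon> a b = Some ([], L_final, n) \<and>
        (\<exists>(c, d) \<in> set L_final.
          \<bar>(INF x\<in>{a..b}. f x) / min (f c) (f d) - 1\<bar> \<le> \<epsilon>) \<and>
        (\<epsilon> \<le> \<epsilon>\<^sub>0 \<longrightarrow>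
          real n \<le> K * (1 / \<epsilon> * integral {a..b} (\<lambda>x. 1 / f x)))))"
proof (rule exI[of _ 16], intro conjI allI impI)
  fix a b :: real
  assume ab: "0 \<le> a \<and> a < b \<and> b \<le> 1"
  show "\<exists>\<epsilon>\<^sub>0>0. \<forall>f :: real \<Rightarrow> real. f ` {a..b} \<subseteq> {0<..1} \<and> 1-lipschitz_on {a..b} f \<longrightarrow>
      (\<forall>\<epsilon>>0. \<exists>L_final n.
        adaptive_bisection f \<epsilon> a b = Some ([], L_final, n) \<and>
        (\<exists>(c, d) \<in> set L_final.
          \<bar>(INF x\<in>{a..b}. f x) / min (f c) (f d) - 1\<bar> \<le> \<epsilon>) \<and>
        (\<epsilon> \<le> \<epsilon>\<^sub>0 \<longrightarrow>
          real n \<le> 16 * (1 / \<epsilon> * integral {a..b} (\<lambda>x. 1 / f x))))"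
  \<comment> \<open>The bound 1 serves the estimate on halves, \<open>b - a\<close> the initial
    interval; the threshold is independent of \<open>f\<close>.\<close>
  proof (rule exI[of _ "min 1 (b - a)"], intro conjI allI impI)
    fix f :: "real \<Rightarrow> real" and \<epsilon> :: real
    assume "f ` {a..b} \<subseteq> {0<..1} \<and> 1-lipschitz_on {a..b} f" and "0 < \<epsilon>"
    then interpret bisection f a b \<epsilon>
      using ab by unfold_locales (auto simp: image_subset_iff)
    obtain F n k where "adaptive_bisection f \<epsilon> a b = Some ([], F, n)" "invariant k [] F n"
      by (rule terminates)
    with approximates_minimum evaluations_le show "\<exists>L_final n.
        adaptive_bisection f \<epsilon> a b = Some ([], L_final, n) \<and>
        (\<exists>(c, d) \<in> set L_final.
          \<bar>(INF x\<in>{a..b}. f x) / min (f c) (f d) - 1\<bar> \<le> \<epsilon>) \<and>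
        (\<epsilon> \<le> min 1 (b - a) \<longrightarrow>
          real n \<le> 16 * (1 / \<epsilon> * integral {a..b} (\<lambda>x. 1 / f x)))"
      by blast
  qed (use ab in auto)
qed simp

end
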